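(* Let $\rho\in(0,1)$ and let $\mathbf{R}=\begin{pmatrix}1&\rho\\ \rho&1\end{pmatrix}$. Let $\mathbf{h}_1,\mathbf{h}_2\in\mathbb{C}^2$ be independent standard circularly-symmetric complex Gaussian random vectors (i.e. $\mathbb{E}\{\mathbf{h}_j\}=\mathbf{0}$, $\mathbb{E}\{\mathbf{h}_j\mathbf{h}_j^{\rm H}\}=\mathbf{I}_2$, $\mathbb{E}\{\mathbf{h}_j\mathbf{h}_j^{\rm T}\}=\mathbf{0}$), and set $\tilde{\mathbf{h}}_j=\mathbf{R}^{1/2}\mathbf{h}_j$ for $j=1,2$. Define the complex random variable $g=\tilde{\mathbf{h}}_1^{\rm H}\tilde{\mathbf{h}}_2/\|\tilde{\mathbf{h}}_2\|$ and ${\rm g}=|g|^2$. Then ${\rm g}$ has probability density function, for $x>0$, $$f_{\rm g}(x)=\frac{1-\rho^2}{2\rho}\left[\mathcal{F}(1+\rho,x)-\mathcal{F}(1-\rho,x)\right],$$ where for $0<\eta<2$ and $x>0$, $$\mathcal{F}(\eta,x)=\frac{\eta}{4(2-\eta)}\exp\left(-\frac{x}{\eta}\right)-\frac{2-x}{8}\exp\left(-\frac{x}{2}\right){\rm Ei}\left[x\left(\frac{1}{2}-\frac{1}{\eta}\right)\right].$$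
   Context: $\mathbf{R}^{1/2}$ denotes the positive semidefinite square root of $\mathbf{R}$; $(\cdot)^{\rm H}$ is conjugate transpose and $\|\cdot\|$ the Euclidean norm. ${\rm Ei}(z)=-\int_{-z}^{\infty}\frac{e^{-t}}{t}\,{\rm d}t$ is the exponential integral (for $z<0$), as in Gradshteyn–Ryzhik eq. (8.211/1). *)

theory Defs
  imports "HOL-Probability.Probability"
begin

text \<open>Exponential integral for negative arguments (Gradshteyn--Ryzhik 8.211/1):
  Ei z = - integral from -z to infinity of exp(-t)/t, for z < 0.\<close>
definition Ei :: "real \<Rightarrow> real" where
  "Ei z = - integral {-z..} (\<lambda>t. exp (-t) / t)"

definition calF :: "real \<Rightarrow> real \<Rightarrow> real" where
  "calF \<eta> x = \<eta> / (4 * (2 - \<eta>)) * exp (- x / \<eta>)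
      - (2 - x) / 8 * exp (- x / 2) * Ei (x * (1/2 - 1/\<eta>))"

definition f_g :: "real \<Rightarrow> real \<Rightarrow> real" where
  "f_g \<rho> x = (1 - \<rho>\<^sup>2) / (2 * \<rho>) * (calF (1 + \<rho>) x - calF (1 - \<rho>) x)"

definition std_cscg_vec :: "'a measure \<Rightarrow> ('a \<Rightarrow> complex ^ 2) \<Rightarrow> bool" where
  "std_cscg_vec M h \<longleftrightarrow>
     prob_space.indep_vars M (\<lambda>_. borel)
       (\<lambda>(i, b) \<omega>. if b then Re (h \<omega> $ i) else Im (h \<omega> $ i)) (UNIV :: (2 \<times> bool) set) \<and>
     (\<forall>i b. distributed M lborel (\<lambda>\<omega>. if b then Re (h \<omega> $ i) else Im (h \<omega> $ i))
              (\<lambda>x. ennreal (normal_density 0 (sqrt (1/2)) x)))"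

end

theory Submission
  imports Defs
begin

text \<open>
  Put \<open>a = 1 + \<rho>\<close> and \<open>b = 1 - \<rho>\<close>, the eigenvalues of \<open>R\<close>. Given \<open>h\<^sub>2\<close>, the conjugate of \<open>g\<close> is a linear form
  in the Gaussian vector \<open>h\<^sub>1\<close>, so \<open>|g|\<^sup>2\<close> is exponential with mean
  \<open>\<sigma> = \<parallel>R h\<^sub>2\<parallel>\<^sup>2 / \<parallel>R\<^sup>1\<^sup>/\<^sup>2 h\<^sub>2\<parallel>\<^sup>2 = (a\<^sup>2 s + b\<^sup>2 r) / (a s + b r)\<close>, where \<open>s\<close> and \<open>r\<close>, the squared moduli of the
  coordinates of \<open>h\<^sub>2\<close> in the eigenbasis, are independent standard exponentials. Since \<open>\<sigma>\<close> depends only on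
  \<open>t = s / r\<close>, whose density is \<open>1 / (1 + t)\<^sup>2\<close>, the density of \<open>|g|\<^sup>2\<close> at \<open>x\<close> is
  the integral of \<open>exp (- x / \<sigma>) / (\<sigma> (1 + t)\<^sup>2)\<close> over \<open>t > 0\<close>. From
  \<open>2 - \<sigma> = a b (1 + t) / (a t + b)\<close> and \<open>\<partial>\<F>/\<partial>\<eta> = exp (- x / \<eta>) / (\<eta> (2 - \<eta>)\<^sup>2)\<close> it follows that this
  integrand has the antiderivative \<open>a b / (2 \<rho>) \<F>(\<sigma>, x)\<close>, and \<open>\<sigma>\<close> increases from \<open>b\<close> to \<open>a\<close>.
\<close>

subsection \<open>Complex Gaussian measure\<close>

lemma measurable_Complex [measurable (raw)]:
  fixes f g :: "'a \<Rightarrow> real"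
  assumes [measurable]: "f \<in> borel_measurable M" "g \<in> borel_measurable M"
  shows "(\<lambda>x. Complex (f x) (g x)) \<in> borel_measurable M"
  by (simp add: Complex_eq)

text \<open>Lebesgue measure is determined by its values on boxes, and a complex box is a product of
  two real intervals. This carries joint densities of real and imaginary parts over to the complex
  plane.\<close>

lemma lborel_complex_eq_distr:
  "(lborel :: complex measure) = distr (lborel \<Otimes>\<^sub>M lborel) borel (\<lambda>(x, y). Complex x y)"
proof (rule lborel_eqI)
  fix l u :: complex
  assume "\<And>b. b \<in> Basis \<Longrightarrow> l \<bullet> b \<le> u \<bullet> b"
  from this[of 1] this[of \<i>] have le: "Re l \<le> Re u" "Im l \<le> Im u"
    by (simp_all add: Basis_complex_def)
  have eq: "(\<lambda>(x, y). Complex x y) -` box l u = {Re l<..<Re u} \<times> {Im l<..<Im u}"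
    by (auto simp: in_box_complex_iff)
  show "emeasure (distr (lborel \<Otimes>\<^sub>M lborel) borel (\<lambda>(x, y). Complex x y)) (box l u)
      = (\<Prod>b\<in>Basis. (u - l) \<bullet> b)"
    using le
    by (subst emeasure_distr)
      (simp_all add: eq space_pair_measure lborel.emeasure_pair_measure_Times ennreal_mult
        Basis_complex_def)
qed simp

text \<open>The standard circularly symmetric law: |z|^2 has mean 1, hence each real component has
  variance 1/2.\<close>

definition cgauss :: "complex measure" where
  "cgauss = density lborel (\<lambda>z. ennreal (exp (- (cmod z)\<^sup>2) / pi))"

lemma sets_cgauss [simp, measurable_cong]: "sets cgauss = sets borel"
  by (simp add: cgauss_def)

lemma space_cgauss [simp]: "space cgauss = UNIV"
  by (simp add: cgauss_def)

lemma (in prob_space) distr_Complex_eq_cgauss: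
  assumes indep: "indep_var borel X borel Y"
    and X: "distributed M lborel X (\<lambda>x. ennreal (normal_density 0 (sqrt (1/2)) x))"
    and Y: "distributed M lborel Y (\<lambda>x. ennreal (normal_density 0 (sqrt (1/2)) x))"
  shows "distr M borel (\<lambda>\<omega>. Complex (X \<omega>) (Y \<omega>)) = cgauss"
proof -
  let ?n = "\<lambda>x. ennreal (normal_density 0 (sqrt (1/2)) x)"
  have [measurable]: "X \<in> borel_measurable M" "Y \<in> borel_measurable M"
    using X Y by (auto simp: distributed_def)
  have 0: "distr M borel X \<Otimes>\<^sub>M distr M borel Y = distr M (borel \<Otimes>\<^sub>M borel) (\<lambda>\<omega>. (X \<omega>, Y \<omega>))"
    using indep by (simp add: indep_var_distribution_eq)
  \<comment> \<open>Independence is stated with target \<open>borel\<close>, the density assumption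
    with target \<open>lborel\<close>; both have the same sets.\<close>
  have eqX: "distr M borel Z = distr M lborel Z" for Z :: "'a \<Rightarrow> real"
    by (rule distr_cong) auto
  have pn: "prob_space (density lborel ?n)"
    using prob_space_normal_density[of "sqrt (1/2)" 0] by simp
  interpret P: prob_space "density lborel ?n" by (rule pn)
  have joint: "distr M (borel \<Otimes>\<^sub>M borel) (\<lambda>\<omega>. (X \<omega>, Y \<omega>))
      = density (lborel \<Otimes>\<^sub>M lborel) (\<lambda>(x, y). ?n x * ?n y)"
    unfolding 0[symmetric] eqX X[THEN distributed_distr_eq_density] Y[THEN distributed_distr_eq_density]
    by (rule pair_measure_density) (auto intro: P.sigma_finite_measure_axioms lborel.sigma_finite_measure_axioms)
  have dens: "?n x * ?n y = ennreal (exp (- (cmod (Complex x y))\<^sup>2) / pi)" for x y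
    by (simp add: normal_density_def ennreal_mult[symmetric] cmod_power2 exp_add[symmetric]
        real_sqrt_mult[symmetric] field_simps)
  have "distr M borel (\<lambda>\<omega>. Complex (X \<omega>) (Y \<omega>))
      = distr (distr M (borel \<Otimes>\<^sub>M borel) (\<lambda>\<omega>. (X \<omega>, Y \<omega>))) borel (\<lambda>(x, y). Complex x y)"
    by (subst distr_distr) (auto simp: comp_def case_prod_unfold Complex_eq)
  also have "\<dots> = cgauss"
    unfolding joint cgauss_def dens
    by (subst lborel_complex_eq_distr) (simp add: density_distr case_prod_unfold)
  finally show ?thesis .
qed

section \<open>Translations, shears and linear maps of determinant one\<close>

lemma nn_integral_lborel_shift:
  fixes f :: "complex \<Rightarrow> ennreal"
  assumes [measurable]: "f \<in> borel_measurable borel"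
  shows "(\<integral>\<^sup>+z. f (z + c) \<partial>lborel) = (\<integral>\<^sup>+z. f z \<partial>lborel)"
proof -
  have "(\<integral>\<^sup>+z. f z \<partial>lborel) = (\<integral>\<^sup>+z. f z \<partial>distr lborel borel ((+) c))"
    by (simp add: lborel_distr_plus)
  then show ?thesis by (simp add: nn_integral_distr add.commute)
qed

text \<open>For fixed second coordinate the shear is a translation, so the first coordinate is
  integrated innermost.\<close>

lemma nn_integral_shear_fst:
  fixes f :: "complex \<times> complex \<Rightarrow> ennreal"
  assumes [measurable]: "f \<in> borel_measurable (borel \<Otimes>\<^sub>M borel)"
  shows "(\<integral>\<^sup>+(x, y). f (x + c * y, y) \<partial>(lborel \<Otimes>\<^sub>M lborel)) = (\<integral>\<^sup>+p. f p \<partial>(lborel \<Otimes>\<^sub>M lborel))"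
  by (simp add: lborel_pair.nn_integral_snd[symmetric] nn_integral_lborel_shift[where f="\<lambda>x. f (x, _)"])

lemma nn_integral_shear_snd:
  fixes f :: "complex \<times> complex \<Rightarrow> ennreal"
  assumes [measurable]: "f \<in> borel_measurable (borel \<Otimes>\<^sub>M borel)"
  shows "(\<integral>\<^sup>+(x, y). f (x, y + c * x) \<partial>(lborel \<Otimes>\<^sub>M lborel)) = (\<integral>\<^sup>+p. f p \<partial>(lborel \<Otimes>\<^sub>M lborel))"
  by (simp add: lborel.nn_integral_fst[symmetric] nn_integral_lborel_shift[where f="\<lambda>y. f (_, y)"])

text \<open>A matrix of determinant one with nonzero lower left entry is a product of three shears,
  each of which preserves Lebesgue measure by translation invariance.\<close>

lemma nn_integral_det_one:
  fixes f :: "complex \<times> complex \<Rightarrow> ennreal"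
  assumes [measurable]: "f \<in> borel_measurable (borel \<Otimes>\<^sub>M borel)"
    and det: "\<alpha> * \<delta> - \<beta> * \<gamma> = 1" and \<gamma>: "\<gamma> \<noteq> 0"
  shows "(\<integral>\<^sup>+(x, y). f (\<alpha> * x + \<beta> * y, \<gamma> * x + \<delta> * y) \<partial>(lborel \<Otimes>\<^sub>M lborel)) =
    (\<integral>\<^sup>+p. f p \<partial>(lborel \<Otimes>\<^sub>M lborel))"
proof -
  \<comment> \<open>In the product of shears, the lower right entry fixes \<open>q\<close> and the
    upper left entry fixes \<open>p\<close>. The upper right entry then agrees because the
    determinant is one.\<close>
  define p q where "p = (\<alpha> - 1) / \<gamma>" and "q = (\<delta> - 1) / \<gamma>"
  define f1 where "f1 = (\<lambda>(x, y). f (x + p * y, y))"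
  define f2 where "f2 = (\<lambda>(x, y). f1 (x, y + \<gamma> * x))"
  have [measurable]: "f1 \<in> borel_measurable (borel \<Otimes>\<^sub>M borel)"
    by (simp add: f1_def)
  have [measurable]: "f2 \<in> borel_measurable (borel \<Otimes>\<^sub>M borel)"
    by (simp add: f2_def)
  have "\<beta> = (\<alpha> * \<delta> - 1) / \<gamma>" using det \<gamma> by (simp add: field_simps)
  then have eq: "f (\<alpha> * x + \<beta> * y, \<gamma> * x + \<delta> * y) = f2 (x + q * y, y)" for x y
    using \<gamma> unfolding f2_def f1_def p_def q_def case_prod_conv \<open>\<beta> = _\<close>
    by (intro arg_cong[where f=f] prod_eqI) (simp_all add: field_simps)
  show ?thesis
    unfolding eq
    using nn_integral_shear_fst[of f2 q] nn_integral_shear_snd[of f1 \<gamma>] nn_integral_shear_fst[of f p]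
    by (simp add: f2_def[symmetric] f1_def[symmetric])
qed

section \<open>The squared modulus of a complex Gaussian\<close>

text \<open>A disc of radius sqrt u has area pi * u, so |z|^2 has constant density pi on the
  half-line. The sign is reversed because measures are compared on the rays \<open>{x<..}\<close>,
  which must have finite mass: their preimages are then discs and not complements of discs.\<close>

lemma distr_neg_cmod_squared:
  "distr lborel borel (\<lambda>z. - (cmod z)\<^sup>2) = density lborel (\<lambda>r. ennreal pi * indicator {..0} r)"
proof (rule measure_eqI_lessThan)
  have 1: "emeasure (distr lborel borel (\<lambda>z. - (cmod z)\<^sup>2)) {x<..} = ennreal (pi * max 0 (- x))" for x
  proof -
    have "(\<lambda>z. - (cmod z)\<^sup>2) -` {x<..} = ball 0 (sqrt (max 0 (- x)))"
    proof (rule set_eqI)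
      fix z :: complex
      have "cmod z < sqrt (max 0 (- x)) \<longleftrightarrow> sqrt ((cmod z)\<^sup>2) < sqrt (max 0 (- x))"
        by simp
      also have "\<dots> \<longleftrightarrow> (cmod z)\<^sup>2 < max 0 (- x)"
        by (rule real_sqrt_less_iff)
      finally show "z \<in> (\<lambda>z. - (cmod z)\<^sup>2) -` {x<..} \<longleftrightarrow> z \<in> ball 0 (sqrt (max 0 (- x)))"
        by (auto simp: max_def) (smt (verit) zero_le_power2)
    qed
    then show ?thesis
      by (simp add: emeasure_distr emeasure_ball unit_ball_vol_2)
  qed
  then show "emeasure (distr lborel borel (\<lambda>z. - (cmod z)\<^sup>2)) {x<..} < \<infinity>" for x
    by simp
  show "emeasure (distr lborel borel (\<lambda>z. - (cmod z)\<^sup>2)) {x<..}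
      = emeasure (density lborel (\<lambda>r. ennreal pi * indicator {..0} r)) {x<..}" for x
  proof -
    have "(\<integral>\<^sup>+ r. ennreal pi * indicator {..0} r * indicator {x<..} r \<partial>lborel)
      = (\<integral>\<^sup>+ r. ennreal pi * indicator {x<..0} r \<partial>lborel)"
      by (intro nn_integral_cong) (auto simp: indicator_def)
    also have "\<dots> = ennreal (pi * max 0 (- x))"
      by (cases "x \<le> 0") (auto simp: nn_integral_cmult_indicator ennreal_mult'[symmetric] max_def)
    finally show ?thesis
      by (simp add: 1 emeasure_density)
  qed
qed auto

text \<open>The Gaussian density depends on |z|^2 only, and its factor 1/pi cancels the constant
  density pi of |z|^2 under area. The last step of the computation undoes the reflection r =
  -|z|^2.\<close>

lemma nn_integral_cgauss_cmod_squared: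
  fixes f :: "real \<Rightarrow> ennreal"
  assumes [measurable]: "f \<in> borel_measurable borel"
  shows "(\<integral>\<^sup>+z. f ((cmod z)\<^sup>2) \<partial>cgauss) = (\<integral>\<^sup>+t. exponential_density 1 t * f t \<partial>lborel)"
proof -
  have "(\<integral>\<^sup>+z. f ((cmod z)\<^sup>2) \<partial>cgauss)
      = (\<integral>\<^sup>+z. (\<lambda>r. ennreal (exp r / pi) * f (- r)) (- (cmod z)\<^sup>2) \<partial>lborel)"
    by (simp add: cgauss_def nn_integral_density)
  also have "\<dots> = (\<integral>\<^sup>+r. ennreal (exp r / pi) * f (- r) \<partial>distr lborel borel (\<lambda>z. - (cmod z)\<^sup>2))"
    by (subst nn_integral_distr) auto
  also have "\<dots> = (\<integral>\<^sup>+r. ennreal pi * indicator {..0} r * (ennreal (exp r / pi) * f (- r)) \<partial>lborel)"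
    unfolding distr_neg_cmod_squared by (rule nn_integral_density) auto
  also have "\<dots> = (\<integral>\<^sup>+r. exponential_density 1 (- r) * f (- r) \<partial>lborel)"
    by (intro nn_integral_cong)
      (auto simp: exponential_density_def indicator_def ennreal_mult'[symmetric] mult.assoc[symmetric])
  also have "\<dots> = (\<integral>\<^sup>+t. exponential_density 1 t * f t \<partial>lborel)"
    using nn_integral_real_affine[of "\<lambda>t. exponential_density 1 t * f t" "-1" 0] by simp
  finally show ?thesis .
qed

lemma prob_space_cgauss: "prob_space cgauss"
proof
  interpret E: prob_space "density lborel (exponential_density 1)"
    by (rule prob_space_exponential_density) simp
  have "emeasure cgauss (space cgauss) = (\<integral>\<^sup>+t. exponential_density 1 t * 1 \<partial>lborel)"
    using nn_integral_cgauss_cmod_squared[of "\<lambda>_. 1"] by simp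
  also have "\<dots> = 1"
    using E.emeasure_space_1 by (simp add: emeasure_density)
  finally show "emeasure cgauss (space cgauss) = 1" .
qed

interpretation cgauss: prob_space cgauss
  by (rule prob_space_cgauss)

interpretation cgauss_pair: pair_prob_space cgauss cgauss
  by standard

section \<open>Unitary invariance of a pair of independent complex Gaussians\<close>

lemma cgauss_pair_eq_density:
  "cgauss \<Otimes>\<^sub>M cgauss = density (lborel \<Otimes>\<^sub>M lborel)
    (\<lambda>(x, y). ennreal (exp (- ((cmod x)\<^sup>2 + (cmod y)\<^sup>2)) / pi\<^sup>2))"
proof -
  have "cgauss \<Otimes>\<^sub>M cgauss = density (lborel \<Otimes>\<^sub>M lborel)
    (\<lambda>(x, y). ennreal (exp (- (cmod x)\<^sup>2) / pi) * ennreal (exp (- (cmod y)\<^sup>2) / pi))"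
    unfolding cgauss_def
    by (rule pair_measure_density)
      (auto simp: cgauss_def[symmetric] intro: cgauss.sigma_finite_measure_axioms lborel.sigma_finite_measure_axioms)
  then show ?thesis
    by (simp add: ennreal_mult[symmetric] exp_add[symmetric] power2_eq_square)
qed

text \<open>The map is unitary of determinant one: it preserves |x|^2 + |y|^2, hence the density,
  and it preserves Lebesgue measure by the shear factorization, which divides by
  \<open>\<gamma>\<close>.\<close>

lemma nn_integral_cgauss_pair_rotate:
  fixes f :: "complex \<times> complex \<Rightarrow> ennreal"
  assumes [measurable]: "f \<in> borel_measurable (borel \<Otimes>\<^sub>M borel)"
    and unit: "(cmod \<alpha>)\<^sup>2 + (cmod \<gamma>)\<^sup>2 = 1" and \<gamma>: "\<gamma> \<noteq> 0"
  shows "(\<integral>\<^sup>+(x, y). f (\<alpha> * x - cnj \<gamma> * y, \<gamma> * x + cnj \<alpha> * y) \<partial>(cgauss \<Otimes>\<^sub>M cgauss)) =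
    (\<integral>\<^sup>+p. f p \<partial>(cgauss \<Otimes>\<^sub>M cgauss))"
proof -
  define d where "d = (\<lambda>(x, y). ennreal (exp (- ((cmod x)\<^sup>2 + (cmod y)\<^sup>2)) / pi\<^sup>2))"
  have [measurable]: "d \<in> borel_measurable (borel \<Otimes>\<^sub>M borel)"
    by (simp add: d_def)
  have "complex_of_real ((cmod \<alpha>)\<^sup>2 + (cmod \<gamma>)\<^sup>2) = 1"
    by (simp add: unit)
  then have det: "\<alpha> * cnj \<alpha> + \<gamma> * cnj \<gamma> = 1"
    by (simp only: of_real_add complex_norm_square)
  have d: "d (\<alpha> * x - cnj \<gamma> * y, \<gamma> * x + cnj \<alpha> * y) = d (x, y)" for x y
  proof -
    \<comment> \<open>Squared moduli are expanded as z * cnj z, where the cross terms cancel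
      algebraically.\<close>
    have "complex_of_real ((cmod (\<alpha> * x - cnj \<gamma> * y))\<^sup>2 + (cmod (\<gamma> * x + cnj \<alpha> * y))\<^sup>2)
        = (\<alpha> * cnj \<alpha> + \<gamma> * cnj \<gamma>) * (x * cnj x + y * cnj y)"
      unfolding of_real_add complex_norm_square by (simp add: algebra_simps)
    also have "\<dots> = complex_of_real ((cmod x)\<^sup>2 + (cmod y)\<^sup>2)"
      unfolding det of_real_add complex_norm_square by simp
    finally show ?thesis
      unfolding d_def case_prod_conv of_real_eq_iff by simp
  qed
  have "(\<integral>\<^sup>+(x, y). f (\<alpha> * x - cnj \<gamma> * y, \<gamma> * x + cnj \<alpha> * y) \<partial>(cgauss \<Otimes>\<^sub>M cgauss))
      = (\<integral>\<^sup>+(x, y). (\<lambda>p. d p * f p) (\<alpha> * x + (- cnj \<gamma>) * y, \<gamma> * x + cnj \<alpha> * y) \<partial>(lborel \<Otimes>\<^sub>M lborel))"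
    unfolding cgauss_pair_eq_density d_def[symmetric]
    by (subst nn_integral_density) (simp_all add: case_prod_unfold d)
  also have "\<dots> = (\<integral>\<^sup>+p. d p * f p \<partial>(lborel \<Otimes>\<^sub>M lborel))"
    using det \<gamma> by (intro nn_integral_det_one) (auto simp: algebra_simps)
  also have "\<dots> = (\<integral>\<^sup>+p. f p \<partial>(cgauss \<Otimes>\<^sub>M cgauss))"
    unfolding cgauss_pair_eq_density d_def[symmetric]
    by (subst nn_integral_density) simp_all
  finally show ?thesis .
qed

lemma nn_integral_cgauss_pair_fst:
  fixes f :: "complex \<Rightarrow> ennreal"
  assumes [measurable]: "f \<in> borel_measurable borel"
  shows "(\<integral>\<^sup>+p. f (fst p) \<partial>(cgauss \<Otimes>\<^sub>M cgauss)) = (\<integral>\<^sup>+x. f x \<partial>cgauss)"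
  by (subst cgauss.nn_integral_fst[symmetric]) (simp_all add: cgauss.emeasure_space_1[simplified])

text \<open>A rotation whose first row is (v, w) / n, with n the norm of (v, w), turns the linear
  form into n times one standard Gaussian.\<close>

lemma nn_integral_cgauss_pair_linear:
  fixes f :: "real \<Rightarrow> ennreal"
  assumes [measurable]: "f \<in> borel_measurable borel"
  shows "(\<integral>\<^sup>+(x, y). f ((cmod (v * x + w * y))\<^sup>2) \<partial>(cgauss \<Otimes>\<^sub>M cgauss)) =
    (\<integral>\<^sup>+t. exponential_density 1 t * f (((cmod v)\<^sup>2 + (cmod w)\<^sup>2) * t) \<partial>lborel)"
proof -
  define n where "n = sqrt ((cmod v)\<^sup>2 + (cmod w)\<^sup>2)"
  have n2: "n\<^sup>2 = (cmod v)\<^sup>2 + (cmod w)\<^sup>2"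
    by (simp add: n_def)
  have "(\<integral>\<^sup>+(x, y). f ((cmod (v * x + w * y))\<^sup>2) \<partial>(cgauss \<Otimes>\<^sub>M cgauss))
      = (\<integral>\<^sup>+p. f (n\<^sup>2 * (cmod (fst p))\<^sup>2) \<partial>(cgauss \<Otimes>\<^sub>M cgauss))"
  proof (cases "w = 0")
    \<comment> \<open>The rotation has lower left entry \<open>- cnj w / n\<close>, which must be
      nonzero; for \<open>w = 0\<close> the form already involves only \<open>x\<close>.\<close>
    case True
    then show ?thesis
      by (simp add: n2 case_prod_unfold norm_mult power_mult_distrib)
  next
    case False
    then have "n \<noteq> 0"
      by (simp add: n_def add_nonneg_eq_0_iff)
    have eq: "(cmod (v * x + w * y))\<^sup>2 = n\<^sup>2 * (cmod (v / n * x - cnj (- cnj w / n) * y))\<^sup>2" for x y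
    proof -
      have "v * x + w * y = n * (v / n * x - cnj (- cnj w / n) * y)"
        using \<open>n \<noteq> 0\<close> by (simp add: field_simps)
      then have "cmod (v * x + w * y) = \<bar>n\<bar> * cmod (v / n * x - cnj (- cnj w / n) * y)"
        by (metis norm_mult norm_of_real)
      then show ?thesis
        by (simp add: power_mult_distrib)
    qed
    have "(cmod (v / n))\<^sup>2 + (cmod (- cnj w / n))\<^sup>2 = 1"
      using \<open>n \<noteq> 0\<close> by (simp add: norm_divide power_divide add_divide_distrib[symmetric] n2[symmetric])
    moreover have "- cnj w / n \<noteq> 0"
      using False \<open>n \<noteq> 0\<close> by simp
    ultimately show ?thesis
      unfolding eq
      using nn_integral_cgauss_pair_rotate[of "\<lambda>p. f (n\<^sup>2 * (cmod (fst p))\<^sup>2)" "v / n" "- cnj w / n"]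
      by simp
  qed
  also have "\<dots> = (\<integral>\<^sup>+x. f (n\<^sup>2 * (cmod x)\<^sup>2) \<partial>cgauss)"
    by (rule nn_integral_cgauss_pair_fst) simp
  also have "\<dots> = (\<integral>\<^sup>+t. exponential_density 1 t * f (n\<^sup>2 * t) \<partial>lborel)"
    by (rule nn_integral_cgauss_cmod_squared[of "\<lambda>t. f (n\<^sup>2 * t)"]) simp
  finally show ?thesis
    by (simp add: n2)
qed

text \<open>(x + y) / sqrt 2 and (x - y) / sqrt 2 are the coordinates in the eigenbasis of R. By
  rotation by 45 degrees they are again independent standard Gaussians, up to a sign that the
  modulus removes.\<close>

lemma nn_integral_cgauss_pair_hadamard:
  fixes f :: "real \<times> real \<Rightarrow> ennreal"
  assumes [measurable]: "f \<in> borel_measurable (borel \<Otimes>\<^sub>M borel)"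
  shows "(\<integral>\<^sup>+(x, y). f ((cmod (x + y))\<^sup>2 / 2, (cmod (x - y))\<^sup>2 / 2) \<partial>(cgauss \<Otimes>\<^sub>M cgauss)) =
    (\<integral>\<^sup>+s. exponential_density 1 s * (\<integral>\<^sup>+r. exponential_density 1 r * f (s, r) \<partial>lborel) \<partial>lborel)"
proof -
  define \<kappa> where "\<kappa> = 1 / sqrt (2::real)"
  have \<kappa>: "\<kappa>\<^sup>2 = 1 / 2" "\<kappa> \<noteq> 0"
    by (simp_all add: \<kappa>_def power_divide)
  have 1: "(cmod (x + y))\<^sup>2 / 2 = (cmod (\<kappa> * x - cnj (- \<kappa>) * y))\<^sup>2" for x y :: complex
  proof -
    have "\<kappa> * x - cnj (- \<kappa>) * y = \<kappa> * (x + y)"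
      by (simp add: algebra_simps)
    then show ?thesis
      by (simp only: norm_mult power_mult_distrib) (simp add: \<kappa>)
  qed
  have 2: "(cmod (x - y))\<^sup>2 / 2 = (cmod ((- \<kappa>) * x + cnj \<kappa> * y))\<^sup>2" for x y :: complex
  proof -
    have "(- \<kappa>) * x + cnj \<kappa> * y = \<kappa> * (y - x)"
      by (simp add: algebra_simps)
    then show ?thesis
      by (simp only: norm_mult power_mult_distrib) (simp add: \<kappa> norm_minus_commute)
  qed
  have "(\<integral>\<^sup>+(x, y). f ((cmod (x + y))\<^sup>2 / 2, (cmod (x - y))\<^sup>2 / 2) \<partial>(cgauss \<Otimes>\<^sub>M cgauss))
      = (\<integral>\<^sup>+p. f ((cmod (fst p))\<^sup>2, (cmod (snd p))\<^sup>2) \<partial>(cgauss \<Otimes>\<^sub>M cgauss))"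
  proof -
    have "(cmod \<kappa>)\<^sup>2 + (cmod (- complex_of_real \<kappa>))\<^sup>2 = 1" "- complex_of_real \<kappa> \<noteq> 0"
      using \<kappa> by simp_all
    then show ?thesis
      unfolding 1 2
      using nn_integral_cgauss_pair_rotate[of "\<lambda>p. f ((cmod (fst p))\<^sup>2, (cmod (snd p))\<^sup>2)" \<kappa> "- \<kappa>"]
      by (simp only: fst_conv snd_conv of_real_minus) simp
  qed
  also have "\<dots> = (\<integral>\<^sup>+x. \<integral>\<^sup>+y. f ((cmod x)\<^sup>2, (cmod y)\<^sup>2) \<partial>cgauss \<partial>cgauss)"
    by (subst cgauss.nn_integral_fst[symmetric]) simp_all
  also have "\<dots> = (\<integral>\<^sup>+x. (\<lambda>s. \<integral>\<^sup>+r. exponential_density 1 r * f (s, r) \<partial>lborel) ((cmod x)\<^sup>2) \<partial>cgauss)"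
    by (subst nn_integral_cgauss_cmod_squared[of "\<lambda>r. f (_, r)"]) simp_all
  also have "\<dots> = (\<integral>\<^sup>+s. exponential_density 1 s * (\<integral>\<^sup>+r. exponential_density 1 r * f (s, r) \<partial>lborel) \<partial>lborel)"
    by (rule nn_integral_cgauss_cmod_squared) simp
  finally show ?thesis .
qed

subsection \<open>The exponential integral and mixtures of exponential densities\<close>

text \<open>Domination by exp (-t) / y. It ensures that the integral defining \<open>Ei\<close>
  converges for negative arguments.\<close>

lemma exp_minus_div_integrable_on:
  assumes "0 < (y::real)"
  shows "(\<lambda>t. exp (- t) / t) integrable_on {y..}"
proof (rule measurable_bounded_by_integrable_imp_integrable_real)
  show "(\<lambda>t. exp (- t) / t) \<in> borel_measurable (lebesgue_on {y..})"
    using assms by (intro continuous_imp_measurable_on_sets_lebesgue continuous_intros) auto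
  show "(\<lambda>t. exp (-1 * t) / y) integrable_on {y..}"
    by (intro integrable_on_divide integrable_on_exp_minus_to_infinity) simp
  show "\<bar>exp (- t) / t\<bar> \<le> exp (-1 * t) / y" if "t \<in> {y..}" for t
    using that assms by (auto intro!: divide_left_mono)
qed simp

text \<open>Splitting the half-line at a fixed point \<open>d\<close> leaves a constant and an
  integral over a compact interval, to which the fundamental theorem of calculus applies.\<close>

lemma Ei_has_real_derivative:
  assumes "z < 0"
  shows "(Ei has_real_derivative exp z / z) (at z)"
proof -
  let ?f = "\<lambda>t::real. exp (- t) / t"
  \<comment> \<open>The interval \<open>{d..c}\<close> stays away from the pole at 0 and has
    \<open>- z\<close> in its interior.\<close>
  define d c where "d = - z / 2" and "c = - z + 1"
  have dc: "0 < d" "d < - z" "- z < c"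
    using assms by (auto simp: d_def c_def)
  have "((\<lambda>y. integral {d..y} ?f) has_real_derivative ?f (- z)) (at (- z) within {d..c})"
    using dc by (intro integral_has_real_derivative continuous_intros) auto
  then have "((\<lambda>y. integral {d..y} ?f) has_real_derivative ?f (- z)) (at (- z))"
    using dc by (subst (asm) at_within_interior) auto
  then have D: "((\<lambda>w. integral {d..- w} ?f) has_real_derivative exp z / z) (at z)"
    using DERIV_chain2[OF _ DERIV_minus[OF DERIV_ident], of "\<lambda>y. integral {d..y} ?f" "?f (- z)" z UNIV]
    by simp
  have Ei_eq: "integral {d..- w} ?f - integral {d..} ?f = Ei w" if "w \<in> {..<- d}" for w
  proof -
    have "(?f has_integral integral {d..- w} ?f + integral {- w..} ?f) ({d..- w} \<union> {- w..})"
    proof (rule has_integral_Un)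
      show "(?f has_integral integral {d..- w} ?f) {d..- w}"
        using dc by (intro integrable_integral integrable_continuous_real continuous_intros) auto
      show "(?f has_integral integral {- w..} ?f) {- w..}"
        using dc that by (intro integrable_integral exp_minus_div_integrable_on) auto
      show "negligible ({d..- w} \<inter> {- w..})"
        by (rule negligible_subset[of "{- w}"]) auto
    qed
    moreover have "{d..- w} \<union> {- w..} = {d..}"
      using that by auto
    ultimately show ?thesis
      by (simp add: Ei_def integral_unique)
  qed
  show ?thesis
  proof (rule has_field_derivative_transform_within_open)
    show "((\<lambda>w. integral {d..- w} ?f - integral {d..} ?f) has_real_derivative exp z / z) (at z)"
      using DERIV_diff[OF D DERIV_const] by simp
    show "z \<in> {..<- d}" using dc by auto
  qed (use Ei_eq in auto)
qed

text \<open>Differentiating \<open>Ei\<close> produces \<open>exp z\<close>, which combines with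
  \<open>exp (- x / 2)\<close> to \<open>exp (- x / \<eta>)\<close>. Both summands then share this
  factor, and a rational identity remains.\<close>

lemma calF_has_real_derivative:
  assumes \<eta>: "0 < \<eta>" "\<eta> < 2" and x: "0 < x"
  shows "((\<lambda>\<eta>. calF \<eta> x) has_real_derivative exp (- x / \<eta>) / (\<eta> * (2 - \<eta>)\<^sup>2)) (at \<eta>)"
proof -
  define z where "z = x * (1/2 - 1/\<eta>)"
  have z: "z = x * (\<eta> - 2) / (2 * \<eta>)" "z < 0"
    using \<eta> x by (auto simp: z_def field_simps)
  have "((\<lambda>\<eta>. x * (1/2 - 1/\<eta>)) has_real_derivative x / \<eta>\<^sup>2) (at \<eta>)"
    using \<eta> by (auto intro!: derivative_eq_intros simp: power2_eq_square)
  then have E: "((\<lambda>\<eta>. Ei (x * (1/2 - 1/\<eta>))) has_real_derivative exp z / z * (x / \<eta>\<^sup>2)) (at \<eta>)"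
    using Ei_has_real_derivative[OF z(2)] unfolding z_def by (rule DERIV_chain2[rotated])
  have e: "exp (- x / 2) * exp z = exp (- x / \<eta>)"
    using \<eta> by (simp add: z_def exp_add[symmetric] algebra_simps)
  have zx: "x / \<eta>\<^sup>2 / z = 2 / (\<eta> * (\<eta> - 2))"
    using \<eta> x by (simp add: z(1) power2_eq_square field_simps)
  have A: "((\<lambda>\<eta>. \<eta> / (4 * (2 - \<eta>)) * exp (- x / \<eta>)) has_real_derivative
      (1 / (2 * (2 - \<eta>)\<^sup>2) + x / (4 * \<eta> * (2 - \<eta>))) * exp (- x / \<eta>)) (at \<eta>)"
    using \<eta>
    by (auto intro!: derivative_eq_intros)
      (simp add: divide_simps power2_eq_square, simp add: algebra_simps)
  have B: "((\<lambda>\<eta>. (2 - x) / 8 * exp (- x / 2) * Ei (x * (1/2 - 1/\<eta>))) has_real_derivative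
      (2 - x) / (4 * \<eta> * (\<eta> - 2)) * exp (- x / \<eta>)) (at \<eta>)"
  proof -
    have "(2 - x) / 8 * exp (- x / 2) * (exp z / z * (x / \<eta>\<^sup>2))
       = (2 - x) / 8 * (x / \<eta>\<^sup>2 / z) * (exp (- x / 2) * exp z)"
      by (simp add: mult_ac)
    also have "\<dots> = (2 - x) / (4 * \<eta> * (\<eta> - 2)) * exp (- x / \<eta>)"
      unfolding e zx using \<eta> by (simp add: divide_simps) (simp add: algebra_simps)
    finally show ?thesis
      using DERIV_cmult[OF E, of "(2 - x) / 8 * exp (- x / 2)"] by simp
  qed
  \<comment> \<open>The terms containing \<open>x\<close> cancel.\<close>
  have "(1 / (2 * (2 - \<eta>)\<^sup>2) + x / (4 * \<eta> * (2 - \<eta>))) - (2 - x) / (4 * \<eta> * (\<eta> - 2))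
      = 1 / (\<eta> * (2 - \<eta>)\<^sup>2)"
    using \<eta> by (simp add: divide_simps power2_eq_square) (simp add: algebra_simps)
  then have "(1 / (2 * (2 - \<eta>)\<^sup>2) + x / (4 * \<eta> * (2 - \<eta>))) * exp (- x / \<eta>)
      - (2 - x) / (4 * \<eta> * (\<eta> - 2)) * exp (- x / \<eta>) = exp (- x / \<eta>) / (\<eta> * (2 - \<eta>)\<^sup>2)"
    by (simp only: left_diff_distrib[symmetric]) simp
  then show ?thesis
    using DERIV_diff[OF A B] by (simp add: calF_def)
qed

text \<open>If \<open>s\<close> and \<open>r\<close> are the squared moduli of the coordinates of \<open>h\<^sub>2\<close> in the eigenbasis of \<open>R\<close>,
  then \<open>mix \<rho> s r\<close> is the conditional variance of \<open>g\<close>.\<close>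

definition mix :: "real \<Rightarrow> real \<Rightarrow> real \<Rightarrow> real" where
  "mix \<rho> s r = ((1 + \<rho>)\<^sup>2 * s + (1 - \<rho>)\<^sup>2 * r) / ((1 + \<rho>) * s + (1 - \<rho>) * r)"

lemma measurable_mix [measurable (raw)]:
  assumes [measurable]: "f \<in> borel_measurable M" "g \<in> borel_measurable M"
  shows "(\<lambda>x. mix \<rho> (f x) (g x)) \<in> borel_measurable M"
  unfolding mix_def by measurable

section \<open>The conditional variance as a function of the ratio t = s / r\<close>

context
  fixes \<rho> :: real
  assumes \<rho>: "0 < \<rho>" "\<rho> < 1"
begin

lemma mix_scale: "r \<noteq> 0 \<Longrightarrow> mix \<rho> s r = mix \<rho> (s / r) 1"
  using \<rho> by (simp add: mix_def divide_simps)

lemma mix_pos: "0 \<le> t \<Longrightarrow> 0 < mix \<rho> t 1"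
  using \<rho> by (simp add: mix_def add_nonneg_pos)

text \<open>This serves twice: it shows that \<open>mix\<close> stays below 2, the range where
  \<open>calF\<close> is differentiated, and it supplies the factor that cancels against the
  derivative of \<open>mix\<close>.\<close>

lemma two_minus_mix:
  assumes "0 \<le> t"
  shows "2 - mix \<rho> t 1 = (1 - \<rho>\<^sup>2) * (1 + t) / ((1 + \<rho>) * t + (1 - \<rho>))"
proof -
  have "0 < (1 + \<rho>) * t + (1 - \<rho>)"
    using \<rho> assms by (simp add: add_nonneg_pos)
  then show ?thesis
    by (simp add: mix_def divide_simps) (simp add: algebra_simps power2_eq_square)
qed

lemma mix_has_real_derivative:
  assumes "0 \<le> t"
  shows "((\<lambda>t. mix \<rho> t 1) has_real_derivative
    2 * \<rho> * (1 - \<rho>\<^sup>2) / ((1 + \<rho>) * t + (1 - \<rho>))\<^sup>2) (at t)"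
proof -
  have "0 < (1 + \<rho>) * t + (1 - \<rho>)"
    using \<rho> assms by (simp add: add_nonneg_pos)
  then show ?thesis
    unfolding mix_def
    by (auto intro!: derivative_eq_intros simp: power2_eq_square)
      (simp add: algebra_simps)
qed

lemma mix_tendsto: "((\<lambda>t. mix \<rho> t 1) \<longlongrightarrow> 1 + \<rho>) at_top"
proof -
  have lim: "filterlim (\<lambda>t. (1 - \<rho>) + (1 + \<rho>) * t) at_top at_top"
    using \<rho> by (intro filterlim_tendsto_add_at_top[OF tendsto_const]
        filterlim_tendsto_pos_mult_at_top[OF tendsto_const _ filterlim_ident]) auto
  \<comment> \<open>Polynomial division of numerator by denominator isolates the limit.\<close>
  have "((\<lambda>t. (1 + \<rho>) - 2 * \<rho> * (1 - \<rho>) / ((1 - \<rho>) + (1 + \<rho>) * t)) \<longlongrightarrow> (1 + \<rho>) - 0) at_top"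
    by (intro tendsto_diff tendsto_const tendsto_divide_0[OF tendsto_const] filterlim_at_top_imp_at_infinity lim)
  moreover have "\<forall>\<^sub>F t in at_top. (1 + \<rho>) - 2 * \<rho> * (1 - \<rho>) / ((1 - \<rho>) + (1 + \<rho>) * t) = mix \<rho> t 1"
    using eventually_ge_at_top[of 0]
  proof eventually_elim
    case (elim t)
    have "0 < (1 - \<rho>) + (1 + \<rho>) * t"
      using \<rho> elim by (simp add: add_pos_nonneg)
    then show ?case
      by (simp add: mix_def divide_simps add.commute) (simp add: algebra_simps power2_eq_square)
  qed
  ultimately show ?thesis
    by (simp add: filterlim_cong[OF refl refl, THEN iffD1, rotated])
qed

lemma nn_integral_eq_f_g:
  assumes x: "0 < x"
  shows "(\<integral>\<^sup>+t. ennreal (exp (- x / mix \<rho> t 1) / mix \<rho> t 1 / (1 + t)\<^sup>2) * indicator {0..} t \<partial>lborel)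
    = ennreal (f_g \<rho> x)"
proof -
  \<comment> \<open>By the chain rule, the derivative of \<open>mix\<close> over
    \<open>(2 - mix \<rho> t 1)\<^sup>2\<close> equals 1 / (C * (1 + t)^2), so \<open>C\<close>
    normalizes the antiderivative.\<close>
  define C where "C = (1 - \<rho>\<^sup>2) / (2 * \<rho>)"
  have r2: "0 < 1 - \<rho>\<^sup>2"
    using \<rho> by (simp add: power_less_one_iff abs_square_less_1)
  have "(\<integral>\<^sup>+t. ennreal (exp (- x / mix \<rho> t 1) / mix \<rho> t 1 / (1 + t)\<^sup>2) * indicator {0..} t \<partial>lborel)
    = ennreal (C * calF (1 + \<rho>) x - C * calF (mix \<rho> 0 1) x)"
  proof (rule nn_integral_FTC_atLeast)
    show "(\<lambda>t. exp (- x / mix \<rho> t 1) / mix \<rho> t 1 / (1 + t)\<^sup>2) \<in> borel_measurable borel"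
      by measurable
    fix t :: real assume t: "0 \<le> t"
    show "0 \<le> exp (- x / mix \<rho> t 1) / mix \<rho> t 1 / (1 + t)\<^sup>2"
      using mix_pos[OF t] by simp
    define D where "D = (1 + \<rho>) * t + (1 - \<rho>)"
    have D: "0 < D"
      using \<rho> t by (simp add: D_def add_nonneg_pos)
    have two: "2 - mix \<rho> t 1 = (1 - \<rho>\<^sup>2) * (1 + t) / D"
      using two_minus_mix[OF t] by (simp add: D_def)
    have "0 < 2 - mix \<rho> t 1"
      unfolding two using D r2 t by simp
    then have "((\<lambda>t. C * calF (mix \<rho> t 1) x) has_real_derivative
        C * (exp (- x / mix \<rho> t 1) / (mix \<rho> t 1 * (2 - mix \<rho> t 1)\<^sup>2) * (2 * \<rho> * (1 - \<rho>\<^sup>2) / D\<^sup>2))) (at t)"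
      unfolding D_def using mix_pos[OF t] x t
      by (intro DERIV_cmult DERIV_chain2[OF calF_has_real_derivative mix_has_real_derivative]) auto
    also have "C * (exp (- x / mix \<rho> t 1) / (mix \<rho> t 1 * (2 - mix \<rho> t 1)\<^sup>2) * (2 * \<rho> * (1 - \<rho>\<^sup>2) / D\<^sup>2))
       = exp (- x / mix \<rho> t 1) / mix \<rho> t 1 / (1 + t)\<^sup>2"
    proof -
      \<comment> \<open>Here \<open>q\<close>, \<open>e\<close>, \<open>m\<close>, \<open>T\<close>
        stand for 1 - \<rho>^2, the exponential, the value of \<open>mix\<close>, and 1 + t.\<close>
      have "q / (2 * \<rho>) * (e / (m * (q * T / D)\<^sup>2) * (2 * \<rho> * q / D\<^sup>2)) = e / m / T\<^sup>2"
        if "0 < q" "0 < m" "0 < T" for q e m T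
        using that D \<rho> by (simp add: field_simps power2_eq_square)
      then show ?thesis
        unfolding two C_def using r2 t mix_pos[OF t] by simp
    qed
    finally show "((\<lambda>t. C * calF (mix \<rho> t 1) x) has_real_derivative
      exp (- x / mix \<rho> t 1) / mix \<rho> t 1 / (1 + t)\<^sup>2) (at t)" .
  next
    have "isCont (\<lambda>\<eta>. calF \<eta> x) (1 + \<rho>)"
      using \<rho> x by (intro DERIV_isCont[OF calF_has_real_derivative]) auto
    then show "((\<lambda>t. C * calF (mix \<rho> t 1) x) \<longlongrightarrow> C * calF (1 + \<rho>) x) at_top"
      by (intro tendsto_mult_left isCont_tendsto_compose[OF _ mix_tendsto])
  qed
  moreover have "mix \<rho> 0 1 = 1 - \<rho>"
    using \<rho> by (simp add: mix_def power2_eq_square)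
  ultimately show ?thesis
    by (simp add: f_g_def C_def right_diff_distrib)
qed

end

section \<open>Quotients and mixtures of exponential variables\<close>

text \<open>The law of the ratio of two independent standard exponentials: substitute s = r * t,
  exchange the integrals, and integrate r * exp (- r * (1 + t)) over r.\<close>

lemma nn_integral_exponential_quotient:
  fixes \<psi> :: "real \<Rightarrow> ennreal"
  assumes [measurable]: "\<psi> \<in> borel_measurable borel"
  shows "(\<integral>\<^sup>+r. exponential_density 1 r * (\<integral>\<^sup>+s. exponential_density 1 s * \<psi> (s / r) \<partial>lborel) \<partial>lborel)
    = (\<integral>\<^sup>+t. \<psi> t * (ennreal (1 / (1 + t)\<^sup>2) * indicator {0..} t) \<partial>lborel)"
proof -
  have gamma: "(\<integral>\<^sup>+r. exponential_density 1 r * (ennreal r * exponential_density 1 (r * t)) \<partial>lborel)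
      = ennreal (1 / (1 + t)\<^sup>2) * indicator {0..} t" for t
  proof (cases "0 \<le> t")
    case True
    \<comment> \<open>Up to the factor 1 / (1 + t)^2 the integrand in \<open>r\<close> is the gamma
      density of shape 2 and rate 1 + t, that is \<open>erlang_density\<close> with index 1, whose
      mass is one.\<close>
    interpret E: prob_space "density lborel (erlang_density 1 (1 + t))"
      by (rule prob_space_erlang_density) (use True in simp)
    have "(\<integral>\<^sup>+r. exponential_density 1 r * (ennreal r * exponential_density 1 (r * t)) \<partial>lborel)
      = (\<integral>\<^sup>+r. ennreal (1 / (1 + t)\<^sup>2) * erlang_density 1 (1 + t) r \<partial>lborel)"
    proof (rule nn_integral_cong)
      fix r :: real
      show "exponential_density 1 r * (ennreal r * exponential_density 1 (r * t))
        = ennreal (1 / (1 + t)\<^sup>2) * erlang_density 1 (1 + t) r"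
      proof (cases "0 \<le> r")
        case r: True
        have "exp (- r) * exp (- (r * t)) = exp ((- 1 - t) * r)"
          by (simp add: exp_add[symmetric] algebra_simps)
        then have "exponential_density 1 r * (r * exponential_density 1 (r * t))
          = 1 / (1 + t)\<^sup>2 * erlang_density 1 (1 + t) r"
          using r True by (simp add: erlang_density_def mult_less_0_iff power2_eq_square)
        then show ?thesis
          using r True by (simp add: ennreal_mult[symmetric])
      qed (simp add: erlang_density_def)
    qed
    also have "\<dots> = ennreal (1 / (1 + t)\<^sup>2) * (\<integral>\<^sup>+r. erlang_density 1 (1 + t) r \<partial>lborel)"
      by (rule nn_integral_cmult) simp
    also have "(\<integral>\<^sup>+r. erlang_density 1 (1 + t) r \<partial>lborel) = 1"
      using E.emeasure_space_1 by (simp add: emeasure_density)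
    finally show ?thesis using True by simp
  next
    case False
    then have zero: "exponential_density 1 r * (ennreal r * exponential_density 1 (r * t)) = 0" for r
      by (cases "r > 0") (auto simp: exponential_density_def mult_pos_neg not_less ennreal_neg)
    show ?thesis
      unfolding zero using False by simp
  qed
  have "(\<integral>\<^sup>+r. exponential_density 1 r * (\<integral>\<^sup>+s. exponential_density 1 s * \<psi> (s / r) \<partial>lborel) \<partial>lborel)
    = (\<integral>\<^sup>+r. exponential_density 1 r *
        (\<integral>\<^sup>+t. ennreal r * (exponential_density 1 (r * t) * \<psi> t) \<partial>lborel) \<partial>lborel)"
  proof (intro nn_integral_cong_AE)
    \<comment> \<open>The substitution needs r > 0. For r < 0 the density vanishes; at r = 0 it does
      not, but this point is null.\<close>
    show "AE r in lborel. exponential_density 1 r * (\<integral>\<^sup>+s. exponential_density 1 s * \<psi> (s / r) \<partial>lborel)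
      = exponential_density 1 r * (\<integral>\<^sup>+t. ennreal r * (exponential_density 1 (r * t) * \<psi> t) \<partial>lborel)"
      using AE_lborel_singleton[of 0]
    proof eventually_elim
      case (elim r)
      show ?case
      proof (cases "r > 0")
        case True
        then show ?thesis
          by (subst nn_integral_real_affine[where c=r and t=0])
            (simp_all add: nn_integral_cmult)
      next
        case False
        then show ?thesis using elim by (simp add: exponential_density_def)
      qed
    qed
  qed
  also have "\<dots> = (\<integral>\<^sup>+r. (\<integral>\<^sup>+t. \<psi> t * (exponential_density 1 r * (ennreal r * exponential_density 1 (r * t))) \<partial>lborel) \<partial>lborel)"
    by (simp add: nn_integral_cmult[symmetric] mult_ac)
  also have "\<dots> = (\<integral>\<^sup>+t. (\<integral>\<^sup>+r. \<psi> t * (exponential_density 1 r * (ennreal r * exponential_density 1 (r * t))) \<partial>lborel) \<partial>lborel)"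
    by (rule lborel_pair.Fubini') simp
  also have "\<dots> = (\<integral>\<^sup>+t. \<psi> t * (ennreal (1 / (1 + t)\<^sup>2) * indicator {0..} t) \<partial>lborel)"
    by (simp add: nn_integral_cmult gamma)
  finally show ?thesis .
qed

lemma nn_integral_exponential_scale:
  fixes f :: "real \<Rightarrow> ennreal"
  assumes [measurable]: "f \<in> borel_measurable borel" and "0 < \<sigma>"
  shows "(\<integral>\<^sup>+t. exponential_density 1 t * f (\<sigma> * t) \<partial>lborel)
    = (\<integral>\<^sup>+x. ennreal (exp (- x / \<sigma>) / \<sigma>) * indicator {0..} x * f x \<partial>lborel)"
  using assms(2)
  by (subst (2) nn_integral_real_affine[where c=\<sigma> and t=0])
    (auto simp: nn_integral_cmult[symmetric] exponential_density_def indicator_def mult.assoc[symmetric]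
      ennreal_mult[symmetric] zero_le_mult_iff mult_less_0_iff intro!: nn_integral_cong)

text \<open>Averaging over the ratio s / r and moving \<open>f\<close> outside by Tonelli turns the
  expectation into an integral of \<open>f\<close> against an explicit density in
  \<open>x\<close>.\<close>

lemma nn_integral_exponential_mix:
  fixes f :: "real \<Rightarrow> ennreal"
  assumes [measurable]: "f \<in> borel_measurable borel" and \<rho>: "0 < \<rho>" "\<rho> < 1"
  shows "(\<integral>\<^sup>+s. exponential_density 1 s * (\<integral>\<^sup>+r. exponential_density 1 r *
      (\<integral>\<^sup>+t. exponential_density 1 t * f (mix \<rho> s r * t) \<partial>lborel) \<partial>lborel) \<partial>lborel)
    = (\<integral>\<^sup>+x. f x * (\<integral>\<^sup>+t. ennreal (exp (- x / mix \<rho> t 1) / mix \<rho> t 1 / (1 + t)\<^sup>2) * indicator {0..} t \<partial>lborel)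
       * indicator {0..} x \<partial>lborel)"
proof -
  \<comment> \<open>\<open>\<psi> t\<close> is the mean of \<open>f\<close> at an exponential
    variable of mean \<open>mix \<rho> t 1\<close>.\<close>
  define \<psi> where "\<psi> = (\<lambda>t. \<integral>\<^sup>+x. ennreal (exp (- x / mix \<rho> t 1) / mix \<rho> t 1) * indicator {0..} x * f x \<partial>lborel)"
  have [measurable]: "\<psi> \<in> borel_measurable borel"
    unfolding \<psi>_def by measurable
  have inner: "exponential_density 1 s * (\<integral>\<^sup>+r. exponential_density 1 r *
      (\<integral>\<^sup>+t. exponential_density 1 t * f (mix \<rho> s r * t) \<partial>lborel) \<partial>lborel)
     = (\<integral>\<^sup>+r. exponential_density 1 s * (exponential_density 1 r * \<psi> (s / r)) \<partial>lborel)" for s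
  proof (cases "0 \<le> s")
    case False
    then show ?thesis by (simp add: exponential_density_def)
  next
    case True
    have "AE r in lborel. exponential_density 1 r * (\<integral>\<^sup>+t. exponential_density 1 t * f (mix \<rho> s r * t) \<partial>lborel)
      = exponential_density 1 r * \<psi> (s / r)"
      using AE_lborel_singleton[of 0]
    proof eventually_elim
      case (elim r)
      show ?case
      proof (cases "r > 0")
        case r: True
        then have "0 \<le> s / r"
          using True by simp
        then show ?thesis
          unfolding \<psi>_def mix_scale[OF \<rho> elim, of s]
          by (subst nn_integral_exponential_scale[OF _ mix_pos[OF \<rho>]]) auto
      next
        case False
        then show ?thesis using elim by (simp add: exponential_density_def)
      qed
    qed
    then have "(\<integral>\<^sup>+r. exponential_density 1 r * (\<integral>\<^sup>+t. exponential_density 1 t * f (mix \<rho> s r * t) \<partial>lborel) \<partial>lborel)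
      = (\<integral>\<^sup>+r. exponential_density 1 r * \<psi> (s / r) \<partial>lborel)"
      by (rule nn_integral_cong_AE)
    then show ?thesis
      by (simp add: nn_integral_cmult)
  qed
  \<comment> \<open>The quotient law is stated with \<open>s\<close> innermost, hence the
    exchange.\<close>
  have "(\<integral>\<^sup>+s. \<integral>\<^sup>+r. exponential_density 1 s * (exponential_density 1 r * \<psi> (s / r)) \<partial>lborel \<partial>lborel)
      = (\<integral>\<^sup>+r. \<integral>\<^sup>+s. exponential_density 1 s * (exponential_density 1 r * \<psi> (s / r)) \<partial>lborel \<partial>lborel)"
    by (rule lborel_pair.Fubini') simp
  also have "\<dots> = (\<integral>\<^sup>+r. exponential_density 1 r * (\<integral>\<^sup>+s. exponential_density 1 s * \<psi> (s / r) \<partial>lborel) \<partial>lborel)"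
    by (simp add: nn_integral_cmult[symmetric] mult_ac)
  also have "\<dots> = (\<integral>\<^sup>+t. \<psi> t * (ennreal (1 / (1 + t)\<^sup>2) * indicator {0..} t) \<partial>lborel)"
    by (rule nn_integral_exponential_quotient) simp
  also have "\<dots> = (\<integral>\<^sup>+t. \<integral>\<^sup>+x. f x * (ennreal (exp (- x / mix \<rho> t 1) / mix \<rho> t 1 / (1 + t)\<^sup>2) * indicator {0..} t)
       * indicator {0..} x \<partial>lborel \<partial>lborel)"
    unfolding \<psi>_def
    by (subst nn_integral_multc[symmetric])
     (auto intro!: nn_integral_cong simp: indicator_def mult_ac
       ennreal_mult''[OF less_imp_le[OF divide_pos_pos[OF exp_gt_zero mix_pos[OF \<rho>]]], symmetric])
  also have "\<dots> = (\<integral>\<^sup>+x. \<integral>\<^sup>+t. f x * (ennreal (exp (- x / mix \<rho> t 1) / mix \<rho> t 1 / (1 + t)\<^sup>2) * indicator {0..} t)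
       * indicator {0..} x \<partial>lborel \<partial>lborel)"
    by (rule lborel_pair.Fubini') simp
  finally show ?thesis
    by (simp add: inner nn_integral_cmult nn_integral_multc)
qed

subsection \<open>The conditional variance and the density\<close>

text \<open>The four real components are independent. Splitting one coordinate into its two parts
  shows that it has law \<open>cgauss\<close>; grouping the parts by coordinate makes the two
  coordinates independent.\<close>

lemma distr_std_cscg_vec:
  fixes h :: "'a \<Rightarrow> complex ^ 2"
  assumes "prob_space M" and "std_cscg_vec M h"
  shows "distr M (borel \<Otimes>\<^sub>M borel) (\<lambda>\<omega>. (h \<omega> $ 1, h \<omega> $ 2)) = cgauss \<Otimes>\<^sub>M cgauss"
proof -
  interpret prob_space M by fact
  define X where "X = (\<lambda>(i, b) \<omega>. if b then Re (h \<omega> $ i) else Im (h \<omega> $ i))"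
  have ind: "indep_vars (\<lambda>_. borel) X UNIV"
    and dX: "distributed M lborel (X (i, b)) (\<lambda>x. ennreal (normal_density 0 (sqrt (1/2)) x))" for i b
    using assms(2) by (simp_all add: std_cscg_vec_def X_def)
  have Complex_X: "(\<lambda>\<omega>. Complex (X (i, True) \<omega>) (X (i, False) \<omega>)) = (\<lambda>\<omega>. h \<omega> $ i)" for i
    by (simp add: X_def)
  have "indep_var borel ((\<lambda>f. f (i, True)) \<circ> (\<lambda>\<omega>. restrict (\<lambda>p. X p \<omega>) {(i, True)}))
      borel ((\<lambda>f. f (i, False)) \<circ> (\<lambda>\<omega>. restrict (\<lambda>p. X p \<omega>) {(i, False)}))" for i
    by (rule indep_var_compose[OF indep_var_restrict[OF ind]]) auto
  then have "indep_var borel (X (i, True)) borel (X (i, False))" for i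
    by (simp add: comp_def)
  then have d: "distr M borel (\<lambda>\<omega>. h \<omega> $ i) = cgauss" for i
    using distr_Complex_eq_cgauss[of "X (i, True)" "X (i, False)"] dX
    unfolding Complex_X by blast
  let ?P = "\<lambda>i. {(i, True), (i, False)}"
  have "indep_var borel ((\<lambda>f. Complex (f (1, True)) (f (1, False))) \<circ> (\<lambda>\<omega>. restrict (\<lambda>p. X p \<omega>) (?P 1)))
      borel ((\<lambda>f. Complex (f (2, True)) (f (2, False))) \<circ> (\<lambda>\<omega>. restrict (\<lambda>p. X p \<omega>) (?P 2)))"
    by (rule indep_var_compose[OF indep_var_restrict[OF ind]]) auto
  then have "indep_var borel (\<lambda>\<omega>. h \<omega> $ 1) borel (\<lambda>\<omega>. h \<omega> $ 2)"
    unfolding Complex_X[symmetric] by (simp add: comp_def)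
  then show ?thesis
    unfolding indep_var_distribution_eq d by simp
qed

section \<open>Hermitian forms of the correlated vectors\<close>

text \<open>By symmetry, (S y)^H (S z) = y^H (S S) z = y^H R z; this removes the square root from
  the problem.\<close>

lemma correlated_quadratic_form:
  fixes S :: "real ^ 2 ^ 2" and y z :: "complex ^ 2"
  assumes sym: "transpose S = S" and sq: "S ** S = (\<chi> i j. if i = j then 1 else \<rho>)"
  shows "(\<Sum>i\<in>UNIV. cnj (\<Sum>k\<in>UNIV. complex_of_real (S $ i $ k) * y $ k) *
      (\<Sum>k\<in>UNIV. complex_of_real (S $ i $ k) * z $ k))
    = cnj (y $ 1) * (z $ 1 + \<rho> * z $ 2) + cnj (y $ 2) * (\<rho> * z $ 1 + z $ 2)"
proof -
  have s: "S $ 2 $ 1 = S $ 1 $ 2"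
    using arg_cong[OF sym, of "\<lambda>A. A $ 1 $ 2"] by (simp add: transpose_def)
  have "S $ 1 $ 1 * S $ 1 $ 1 + S $ 1 $ 2 * S $ 1 $ 2 = 1"
    "S $ 1 $ 1 * S $ 1 $ 2 + S $ 1 $ 2 * S $ 2 $ 2 = \<rho>"
    "S $ 1 $ 2 * S $ 1 $ 2 + S $ 2 $ 2 * S $ 2 $ 2 = 1"
    using sq by (simp_all add: vec_eq_iff matrix_matrix_mult_def forall_2 sum_2 s)
  then have c: "complex_of_real (S $ 1 $ 1) * complex_of_real (S $ 1 $ 1)
       + complex_of_real (S $ 1 $ 2) * complex_of_real (S $ 1 $ 2) = 1"
    "complex_of_real (S $ 1 $ 1) * complex_of_real (S $ 1 $ 2)
       + complex_of_real (S $ 1 $ 2) * complex_of_real (S $ 2 $ 2) = \<rho>"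
    "complex_of_real (S $ 1 $ 2) * complex_of_real (S $ 1 $ 2)
       + complex_of_real (S $ 2 $ 2) * complex_of_real (S $ 2 $ 2) = 1"
    by (simp_all only: of_real_mult[symmetric] of_real_add[symmetric] of_real_1)
  let ?a = "complex_of_real (S $ 1 $ 1)" and ?b = "complex_of_real (S $ 1 $ 2)"
    and ?d = "complex_of_real (S $ 2 $ 2)"
  have "(\<Sum>i\<in>UNIV. cnj (\<Sum>k\<in>UNIV. complex_of_real (S $ i $ k) * y $ k) *
      (\<Sum>k\<in>UNIV. complex_of_real (S $ i $ k) * z $ k))
    = cnj (y $ 1) * ((?a * ?a + ?b * ?b) * z $ 1 + (?a * ?b + ?b * ?d) * z $ 2)
      + cnj (y $ 2) * ((?a * ?b + ?b * ?d) * z $ 1 + (?b * ?b + ?d * ?d) * z $ 2)"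
    by (simp add: sum_2 s algebra_simps)
  then show ?thesis
    unfolding c by simp
qed

text \<open>\<open>qform \<rho> z\<close> is the Hermitian form \<open>z\<^sup>H R z\<close>, written in the eigenbasis of \<open>R\<close>.\<close>

definition qform :: "real \<Rightarrow> complex \<times> complex \<Rightarrow> real" where
  "qform \<rho> z = (1 + \<rho>) * ((cmod (fst z + snd z))\<^sup>2 / 2) + (1 - \<rho>) * ((cmod (fst z - snd z))\<^sup>2 / 2)"

lemma qform_eq:
  fixes z1 z2 :: complex
  shows "complex_of_real (qform \<rho> (z1, z2)) = cnj z1 * (z1 + \<rho> * z2) + cnj z2 * (\<rho> * z1 + z2)"
  unfolding qform_def of_real_add of_real_mult of_real_divide complex_norm_square
  by (simp add: algebra_simps add_divide_distrib diff_divide_distrib)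

lemma norm_correlated:
  fixes S :: "real ^ 2 ^ 2" and z :: "complex ^ 2"
  assumes "transpose S = S" and "S ** S = (\<chi> i j. if i = j then 1 else \<rho>)"
  shows "norm (\<chi> i. \<Sum>k\<in>UNIV. complex_of_real (S $ i $ k) * z $ k) = sqrt (qform \<rho> (z $ 1, z $ 2))"
proof -
  let ?v = "\<chi> i. \<Sum>k\<in>UNIV. complex_of_real (S $ i $ k) * z $ k"
  have "complex_of_real (\<Sum>i\<in>UNIV. (cmod (?v $ i))\<^sup>2) = (\<Sum>i\<in>UNIV. cnj (?v $ i) * ?v $ i)"
    unfolding of_real_sum complex_norm_square by (simp only: mult.commute)
  also have "\<dots> = complex_of_real (qform \<rho> (z $ 1, z $ 2))"
    using correlated_quadratic_form[OF assms, of z z] by (simp add: qform_eq)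
  finally show ?thesis
    unfolding of_real_eq_iff by (simp add: norm_vec_def L2_set_def)
qed

text \<open>The coefficients are those of the conjugate of \<open>g\<close> as a linear form in \<open>y = h\<^sub>1\<close>, given \<open>z = h\<^sub>2\<close>.\<close>

definition gain :: "real \<Rightarrow> complex \<times> complex \<Rightarrow> complex \<times> complex \<Rightarrow> real" where
  "gain \<rho> z y =
    (cmod (cnj ((fst z + complex_of_real \<rho> * snd z) / complex_of_real (sqrt (qform \<rho> z))) * fst y
     + cnj ((complex_of_real \<rho> * fst z + snd z) / complex_of_real (sqrt (qform \<rho> z))) * snd y))\<^sup>2"

text \<open>The left side is ||R z||^2 / (z^H R z), and in the eigenbasis R acts by 1 + \<rho> and 1
  - \<rho>. If the form vanishes, both sides are 0 by the convention for division by zero.\<close>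

lemma gain_coefficients:
  fixes z1 z2 :: complex
  assumes "0 < \<rho>" "\<rho> < 1"
  shows "(cmod (cnj ((z1 + \<rho> * z2) / sqrt (qform \<rho> (z1, z2)))))\<^sup>2 + (cmod (cnj ((\<rho> * z1 + z2) / sqrt (qform \<rho> (z1, z2)))))\<^sup>2
    = mix \<rho> ((cmod (z1 + z2))\<^sup>2 / 2) ((cmod (z1 - z2))\<^sup>2 / 2)"
proof -
  have nn: "0 \<le> qform \<rho> (z1, z2)"
    using assms by (simp add: qform_def)
  have "complex_of_real ((cmod (z1 + \<rho> * z2))\<^sup>2 + (cmod (\<rho> * z1 + z2))\<^sup>2)
     = complex_of_real ((1 + \<rho>)\<^sup>2 * ((cmod (z1 + z2))\<^sup>2 / 2) + (1 - \<rho>)\<^sup>2 * ((cmod (z1 - z2))\<^sup>2 / 2))"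
    unfolding of_real_add of_real_mult of_real_divide complex_norm_square
    by (simp add: algebra_simps add_divide_distrib diff_divide_distrib power2_eq_square)
  then have "(cmod (z1 + \<rho> * z2))\<^sup>2 + (cmod (\<rho> * z1 + z2))\<^sup>2
     = (1 + \<rho>)\<^sup>2 * ((cmod (z1 + z2))\<^sup>2 / 2) + (1 - \<rho>)\<^sup>2 * ((cmod (z1 - z2))\<^sup>2 / 2)"
    unfolding of_real_eq_iff .
  then show ?thesis
    using nn unfolding mix_def complex_mod_cnj norm_divide power_divide add_divide_distrib[symmetric]
    by (simp add: qform_def)
qed

lemma measurable_gain [measurable]:
  "(\<lambda>p. gain \<rho> (fst p) (snd p)) \<in> borel_measurable ((borel \<Otimes>\<^sub>M borel) \<Otimes>\<^sub>M (borel \<Otimes>\<^sub>M borel))"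
proof -
  have [measurable]: "cnj \<in> borel \<rightarrow>\<^sub>M borel"
    by (intro borel_measurable_continuous_onI continuous_intros)
  show ?thesis
    unfolding gain_def qform_def by measurable
qed

section \<open>Conditioning on the second vector and the resulting density\<close>

text \<open>For fixed \<open>z\<close> the gain is the squared modulus of a linear form in a
  Gaussian pair, so it is exponential with mean \<open>mix\<close>. That mean depends on
  \<open>z\<close> only through the two squared eigencoordinates.\<close>

lemma nn_integral_gain:
  fixes f :: "real \<Rightarrow> ennreal"
  assumes [measurable]: "f \<in> borel_measurable borel" and \<rho>: "0 < \<rho>" "\<rho> < 1"
  shows "(\<integral>\<^sup>+z. \<integral>\<^sup>+y. f (gain \<rho> z y) \<partial>(cgauss \<Otimes>\<^sub>M cgauss) \<partial>(cgauss \<Otimes>\<^sub>M cgauss))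
    = (\<integral>\<^sup>+s. exponential_density 1 s * (\<integral>\<^sup>+r. exponential_density 1 r *
      (\<integral>\<^sup>+t. exponential_density 1 t * f (mix \<rho> s r * t) \<partial>lborel) \<partial>lborel) \<partial>lborel)"
proof -
  have "(\<integral>\<^sup>+y. f (gain \<rho> (z1, z2) y) \<partial>(cgauss \<Otimes>\<^sub>M cgauss))
    = (\<integral>\<^sup>+t. exponential_density 1 t * f (mix \<rho> ((cmod (z1 + z2))\<^sup>2 / 2) ((cmod (z1 - z2))\<^sup>2 / 2) * t) \<partial>lborel)"
    for z1 z2
    unfolding gain_coefficients[OF \<rho>, symmetric]
    by (subst nn_integral_cgauss_pair_linear[symmetric]) (simp_all add: gain_def case_prod_unfold)
  then have "(\<integral>\<^sup>+z. \<integral>\<^sup>+y. f (gain \<rho> z y) \<partial>(cgauss \<Otimes>\<^sub>M cgauss) \<partial>(cgauss \<Otimes>\<^sub>M cgauss))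
    = (\<integral>\<^sup>+(z1, z2). (\<lambda>(s, r). \<integral>\<^sup>+t. exponential_density 1 t * f (mix \<rho> s r * t) \<partial>lborel)
         ((cmod (z1 + z2))\<^sup>2 / 2, (cmod (z1 - z2))\<^sup>2 / 2) \<partial>(cgauss \<Otimes>\<^sub>M cgauss))"
    by (intro nn_integral_cong) (auto split: prod.split)
  also have "\<dots> = (\<integral>\<^sup>+s. exponential_density 1 s * (\<integral>\<^sup>+r. exponential_density 1 r *
      (\<integral>\<^sup>+t. exponential_density 1 t * f (mix \<rho> s r * t) \<partial>lborel) \<partial>lborel) \<partial>lborel)"
    by (subst nn_integral_cgauss_pair_hadamard) simp_all
  finally show ?thesis .
qed

theorem theorem1:
  fixes M :: "'a measure" and \<rho> :: real
    and S :: "real ^ 2 ^ 2"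
    and h1 h2 :: "'a \<Rightarrow> complex ^ 2"
  assumes "prob_space M"
    and "0 < \<rho>" and "\<rho> < 1"
    and "transpose S = S"
    and "\<forall>v :: real ^ 2. 0 \<le> v \<bullet> (S *v v)"
    and "S ** S = (\<chi> i j. if i = j then 1 else \<rho>)"
    and "std_cscg_vec M h1" and "std_cscg_vec M h2"
    and "prob_space.indep_var M borel h1 borel h2"
  shows "distributed M lborel
     (\<lambda>\<omega>. let ht1 = (\<chi> i. \<Sum>k\<in>UNIV. complex_of_real (S $ i $ k) * h1 \<omega> $ k);
               ht2 = (\<chi> i. \<Sum>k\<in>UNIV. complex_of_real (S $ i $ k) * h2 \<omega> $ k);
               g = (\<Sum>i\<in>UNIV. cnj (ht1 $ i) * ht2 $ i) / complex_of_real (norm ht2)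
           in (cmod g)\<^sup>2)
     (\<lambda>x. ennreal (if 0 < x then f_g \<rho> x else 0))"
proof -
  interpret prob_space M by fact
  note \<rho> = \<open>0 < \<rho>\<close> \<open>\<rho> < 1\<close>
  let ?pair = "\<lambda>h \<omega>. ((h :: 'a \<Rightarrow> complex ^ 2) \<omega> $ 1, h \<omega> $ 2)"
  let ?B = "borel \<Otimes>\<^sub>M borel :: (complex \<times> complex) measure"
  have [measurable]: "(\<lambda>v :: complex ^ 2. (v $ 1, v $ 2)) \<in> borel \<rightarrow>\<^sub>M ?B"
    unfolding borel_prod by (intro borel_measurable_continuous_onI continuous_intros)
  have h [measurable]: "h1 \<in> borel_measurable M" "h2 \<in> borel_measurable M"
    using \<open>indep_var borel h1 borel h2\<close> by (auto dest: indep_var_rv1 indep_var_rv2)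
  have pair [measurable]: "?pair h1 \<in> M \<rightarrow>\<^sub>M ?B" "?pair h2 \<in> M \<rightarrow>\<^sub>M ?B"
    using measurable_compose[OF h(1), of "\<lambda>v. (v $ 1, v $ 2)" ?B]
      measurable_compose[OF h(2), of "\<lambda>v. (v $ 1, v $ 2)" ?B] by simp_all
  have "indep_var ?B ((\<lambda>v. (v $ 1, v $ 2)) \<circ> h1) ?B ((\<lambda>v. (v $ 1, v $ 2)) \<circ> h2)"
    by (rule indep_var_compose) (use \<open>indep_var borel h1 borel h2\<close> in auto)
  then have "distr M ?B (?pair h1) \<Otimes>\<^sub>M distr M ?B (?pair h2)
      = distr M (?B \<Otimes>\<^sub>M ?B) (\<lambda>\<omega>. (?pair h1 \<omega>, ?pair h2 \<omega>))"
    unfolding indep_var_distribution_eq by (simp add: comp_def)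
  then have joint: "distr M (?B \<Otimes>\<^sub>M ?B) (\<lambda>\<omega>. (?pair h1 \<omega>, ?pair h2 \<omega>))
      = (cgauss \<Otimes>\<^sub>M cgauss) \<Otimes>\<^sub>M (cgauss \<Otimes>\<^sub>M cgauss)"
    by (simp add: distr_std_cscg_vec[OF \<open>prob_space M\<close>] assms)
  define T where "T = (\<lambda>\<omega>. gain \<rho> (?pair h2 \<omega>) (?pair h1 \<omega>))"
  have [measurable]: "T \<in> borel_measurable M"
    using measurable_compose[of "\<lambda>\<omega>. (?pair h2 \<omega>, ?pair h1 \<omega>)" M _ "\<lambda>p. gain \<rho> (fst p) (snd p)", OF _ measurable_gain]
    by (simp add: T_def)
  have [measurable]: "(\<lambda>p. gain \<rho> (snd p) (fst p)) \<in> borel_measurable (?B \<Otimes>\<^sub>M ?B)"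
    using measurable_compose[of "\<lambda>p. (snd p, fst p)" "?B \<Otimes>\<^sub>M ?B" _ "\<lambda>p. gain \<rho> (fst p) (snd p)", OF _ measurable_gain]
    by simp
  let ?I = "\<lambda>x. \<integral>\<^sup>+t. ennreal (exp (- x / mix \<rho> t 1) / mix \<rho> t 1 / (1 + t)\<^sup>2) * indicator {0..} t \<partial>lborel"
  \<comment> \<open>Writing the density as the integral \<open>?I\<close> also yields its
    measurability.\<close>
  have dens: "ennreal (if 0 < x then f_g \<rho> x else 0) = ?I x * indicator {0<..} x" for x
    using nn_integral_eq_f_g[OF \<rho>, of x] by (auto simp: indicator_def)
  have "distributed M lborel T (\<lambda>x. ennreal (if 0 < x then f_g \<rho> x else 0))"
    unfolding distributed_def
  proof (intro conjI)
    show "(\<lambda>x. ennreal (if 0 < x then f_g \<rho> x else 0)) \<in> borel_measurable lborel"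
      unfolding dens by measurable
    then have [measurable]: "(\<lambda>x. ennreal (if 0 < x then f_g \<rho> x else 0)) \<in> borel_measurable borel"
      by simp
    show "distr M lborel T = density lborel (\<lambda>x. ennreal (if 0 < x then f_g \<rho> x else 0))"
    proof (rule measure_eqI)
      fix A assume "A \<in> sets (distr M lborel T)"
      then have [measurable]: "A \<in> sets borel" by simp
      have "emeasure (distr M lborel T) A = (\<integral>\<^sup>+\<omega>. indicator A (T \<omega>) \<partial>M)"
        by (simp add: nn_integral_distr[symmetric, of T M lborel])
      also have "\<dots> = (\<integral>\<^sup>+p. indicator A (gain \<rho> (snd p) (fst p)) \<partial>((cgauss \<Otimes>\<^sub>M cgauss) \<Otimes>\<^sub>M (cgauss \<Otimes>\<^sub>M cgauss)))"
        unfolding joint[symmetric] by (subst nn_integral_distr) (simp_all add: T_def)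
      \<comment> \<open>By Tonelli the variable of \<open>h1\<close> is integrated first, which is
        the conditioning on \<open>h2\<close>.\<close>
      also have "\<dots> = (\<integral>\<^sup>+z. \<integral>\<^sup>+y. indicator A (gain \<rho> z y) \<partial>(cgauss \<Otimes>\<^sub>M cgauss) \<partial>(cgauss \<Otimes>\<^sub>M cgauss))"
      proof -
        interpret P: pair_sigma_finite "cgauss \<Otimes>\<^sub>M cgauss" "cgauss \<Otimes>\<^sub>M cgauss"
          by (intro pair_sigma_finite.intro cgauss_pair.sigma_finite_measure_axioms)
        show ?thesis
          by (subst P.nn_integral_snd[symmetric]) simp_all
      qed
      also have "\<dots> = (\<integral>\<^sup>+x. indicator A x * ?I x * indicator {0..} x \<partial>lborel)"
        by (subst nn_integral_gain[OF _ \<rho>], simp) (rule nn_integral_exponential_mix[OF _ \<rho>], simp)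
      also have "\<dots> = (\<integral>\<^sup>+x. ennreal (if 0 < x then f_g \<rho> x else 0) * indicator A x \<partial>lborel)"
        unfolding dens
      proof (rule nn_integral_cong_AE)
        \<comment> \<open>The half-lines \<open>{0..}\<close> and \<open>{0<..}\<close> differ only
          in the null point 0.\<close>
        show "AE x in lborel. indicator A x * ?I x * indicator {0..} x = ?I x * indicator {0<..} x * indicator A x"
          using AE_lborel_singleton[of 0] by eventually_elim (auto simp: indicator_def)
      qed
      also have "\<dots> = emeasure (density lborel (\<lambda>x. ennreal (if 0 < x then f_g \<rho> x else 0))) A"
        by (rule emeasure_density[symmetric]) simp_all
      finally show "emeasure (distr M lborel T) A
        = emeasure (density lborel (\<lambda>x. ennreal (if 0 < x then f_g \<rho> x else 0))) A" .
    qed simp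
  qed simp
  moreover have "(let ht1 = (\<chi> i. \<Sum>k\<in>UNIV. complex_of_real (S $ i $ k) * h1 \<omega> $ k);
               ht2 = (\<chi> i. \<Sum>k\<in>UNIV. complex_of_real (S $ i $ k) * h2 \<omega> $ k);
               g = (\<Sum>i\<in>UNIV. cnj (ht1 $ i) * ht2 $ i) / complex_of_real (norm ht2)
           in (cmod g)\<^sup>2) = T \<omega>" for \<omega>
  proof -
    let ?q = "complex_of_real (sqrt (qform \<rho> (?pair h2 \<omega>)))"
    let ?g = "(cnj (h1 \<omega> $ 1) * (h2 \<omega> $ 1 + \<rho> * h2 \<omega> $ 2) + cnj (h1 \<omega> $ 2) * (\<rho> * h2 \<omega> $ 1 + h2 \<omega> $ 2)) / ?q"
    \<comment> \<open>Conjugation leaves the modulus unchanged and makes the expression complex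
      linear in \<open>h1\<close>, as in \<open>gain\<close>.\<close>
    have "T \<omega> = (cmod (cnj ?g))\<^sup>2"
      unfolding T_def gain_def by (simp add: distrib_left add_divide_distrib mult_ac)
    then show ?thesis
      unfolding Let_def complex_mod_cnj
      by (simp only: vec_lambda_beta correlated_quadratic_form[OF assms(4,6)] norm_correlated[OF assms(4,6)])
  qed
  ultimately show ?thesis
    by presburger
qed

end
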